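(* Let $X,Y$ be compact metric spaces, $\omega$ a Radon measure on $X$, and let $\mathcal F\subset C^+(X)$ and $\mathcal T:\mathcal F\to C_s(X,Y)$ be such that $\mathcal F$ is $\mathcal T$-convex and property (A3') (defined in the context) holds, with functions $h_{t,y}$, $y\in Y$, $\alpha_y<t<\beta_y$. Let $\{\mu_l\}_{l\ge1}$ be a sequence of discrete Radon measures on $Y$, $\mu_l=\sum_{i=1}^{N_l}g_i^{l}\,\delta_{p_i^{l}}$ with $N_l\ge 2$, $p_1^l,\dots,p_{N_l}^l$ distinct points of $Y$ and $g_i^l>0$, such that $\mu_l\to\mu$ weakly, where $\mu$ is a Radon measure on $Y$, and $\mu_l(Y)=\omega(X)$ for $l\ge1$. For each $l$ let $\rho_l$ be a function of the form $$\rho_l(x)=\max_{1\le i\le N_l}h_{b_i^l,p_i^l}(x),\qquad b_i^l\in(\alpha_{p_i^l},\beta_{p_i^l}),$$ with $M_{\mathcal T(\rho_l)}=\mu_l$. Assume that there exists $R_0>0$ such that $R_0\in\mathrm{Range}(\rho_l)$ for all $l\ge1$ and $R_0<\lim_{t\to\alpha_y^+}h_{t,y}(x)$ for all $x\in X$, $y\in Y$. Suppose that (i) for each $R_1>0$ there exists $C_{R_1}>0$ such that $C_{R_1}^{-1}\le h_{t,y}\le C_{R_1}$ on $X$ whenever $y\in Y$, $t\in(\alpha_y,\beta_y)$ and $R_1\in\mathrm{Range}(h_{t,y})$; (ii) for any $C_1>C_0>0$, the family $\{f\in\mathcal F: C_0\le f\le C_1\text{ in }X\}$ is compact in $C(X)$.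 Then there exists $\rho\in\mathcal F$ satisfying $M_{\mathcal T(\rho)}=\mu$.
   Context: Let $X,Y$ be compact metric spaces and $\omega$ a Radon measure on $X$ (nonnegative, finite, completed). A set-valued map $\Phi$ from $X$ to $Y$ assigns to each $x\in X$ a nonempty subset $\Phi(x)\subset Y$. $Y^X$ denotes the class of set-valued maps $\Phi$ from $X$ to $Y$ such that $\Phi(x)$ is a singleton for $\omega$-a.e. $x$. A map $\Phi\in Y^X$ is continuous at $x_0\in X$ if, whenever $x_k\to x_0$ and $y_k\in\Phi(x_k)$, there are a subsequence $y_{k_j}$ and $y_0\in\Phi(x_0)$ with $y_{k_j}\to y_0$. $C(X,Y)$ is the class of $\Phi\in Y^X$ continuous at every point of $X$, and $C_s(X,Y)$ is the class of $\Phi\in C(X,Y)$ with $\Phi(X)=\bigcup_{x\in X}\Phi(x)=Y$. For $\Phi\in C_s(X,Y)$ and $E\subset Y$, $\Phi^{-1}(E)=\{x\in X:\Phi(x)\cap E\ne\emptyset\}$, and $M_\Phi(E)=\omega(\Phi^{-1}(E))$, which is a Radon measure on $Y$. $C(X)$ is the set of real continuous functions on $X$ with the topology of uniform convergence; $C^+(X)$ is the set of continuous positive functions on $X$. A map $\mathcal T:\mathcal F\to C_s(X,Y)$, $\mathcal F\subset C(X)$, is continuous at $\phi\in\mathcal F$ if whenever $\phi_j\in\mathcal F$, $\phi_j\to\phi$ uniformly in $X$, $x_0\in X$ and $y_j\in\mathcal T(\phi_j)(x_0)$, there is a subsequence $y_{j_\ell}$ converging to some $y_0\in\mathcal T(\phi)(x_0)$.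 A class $\mathcal F\subset C^+(X)$ is $\mathcal T$-convex if: (A1') $f_1,f_2\in\mathcal F$ implies $f_1\vee f_2=\max\{f_1,f_2\}\in\mathcal F$; and $\mathcal T:\mathcal F\to C_s(X,Y)$ is a map that is continuous at each $\phi\in\mathcal F$ and satisfies (A2'): if $\phi_1,\phi_2\in\mathcal F$ and $\phi_1(x_0)\ge\phi_2(x_0)$, then $\mathcal T(\phi_1)(x_0)\subset\mathcal T(\phi_1\vee\phi_2)(x_0)$. Property (A3'): for each $y_0\in Y$ there exist an interval $(\alpha_{y_0},\beta_{y_0})$ (endpoints possibly infinite) and a family $\{h_{t,y_0}\}_{\alpha_{y_0}<t<\beta_{y_0}}\subset\mathcal F$ such that (a) $y_0\in\mathcal T(h_{t,y_0})(x)$ for all $x\in X$; (b) $h_{t,y_0}\ge h_{s,y_0}$ for $t\le s$; (c) $h_{t,y_0}\to 0$ uniformly as $t\to\beta_{y_0}$; (d) $\max_{x\in X}|h_{t',y_0}(x)-h_{t,y_0}(x)|\to 0$ as $t'\to t$, for $\alpha_{y_0}<t<\beta_{y_0}$. *)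

theory Defs
  imports "HOL-Probability.Probability"
begin

section \<open>Radon measures on compact metric spaces\<close>

text \<open>Compact metric spaces are metric types whose universe is compact. A Radon measure lives on
  the Borel sets; its completed version is its completion.\<close>

definition radon_measure :: "'a::metric_space measure \<Rightarrow> bool" where
  "radon_measure M \<longleftrightarrow> sets M = sets borel \<and> finite_measure M \<and>
     (\<forall>E\<in>sets borel. emeasure M E = (SUP K\<in>{K. compact K \<and> K \<subseteq> E}. emeasure M K))"

definition completed_radon_measure :: "'a::metric_space measure \<Rightarrow> bool" where
  "completed_radon_measure M \<longleftrightarrow> (\<exists>M0. radon_measure M0 \<and> M = completion M0)"

definition weakly_converges :: "(nat \<Rightarrow> 'a::metric_space measure) \<Rightarrow> 'a measure \<Rightarrow> bool" where
  "weakly_converges Ms M \<longleftrightarrow>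
     (\<forall>f::'a \<Rightarrow> real. continuous_on UNIV f \<longrightarrow> (\<lambda>l. \<integral>y. f y \<partial>Ms l) \<longlonglongrightarrow> (\<integral>y. f y \<partial>M))"

definition dirac_sum :: "nat \<Rightarrow> (nat \<Rightarrow> real) \<Rightarrow> (nat \<Rightarrow> 'a::metric_space) \<Rightarrow> 'a measure" where
  "dirac_sum N g p = measure_of UNIV (sets borel)
     (\<lambda>E. \<Sum>i=1..N. ennreal (g i) * emeasure (return borel (p i)) E)"

lemma sets_dirac_sum: "sets (dirac_sum N g p) = sets borel"
  unfolding dirac_sum_def using sets.sigma_sets_eq[of borel] by simp

lemma emeasure_dirac_sum:
  assumes "E \<in> sets borel"
  shows "emeasure (dirac_sum N g p) E = (\<Sum>i=1..N. ennreal (g i) * indicator E (p i))"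
proof -
  have "emeasure (dirac_sum N g p) E =
      (\<Sum>i=1..N. ennreal (g i) * emeasure (return borel (p i)) E)"
  proof (rule emeasure_measure_of[OF dirac_sum_def])
    show "countably_additive (sets (dirac_sum N g p))
        (\<lambda>E. \<Sum>i=1..N. ennreal (g i) * emeasure (return borel (p i)) E)"
    proof (rule countably_additiveI)
      fix A :: "nat \<Rightarrow> 'a set"
      assume A: "range A \<subseteq> sets (dirac_sum N g p)" "disjoint_family A"
      have "(\<Sum>n. emeasure (return borel (p i)) (A n)) = emeasure (return borel (p i)) (\<Union>n. A n)"
        for i using A by (intro suminf_emeasure) (auto simp: sets_dirac_sum)
      then show "(\<Sum>n. \<Sum>i=1..N. ennreal (g i) * emeasure (return borel (p i)) (A n)) =
          (\<Sum>i=1..N. ennreal (g i) * emeasure (return borel (p i)) (\<Union>n. A n))"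
        by (simp add: suminf_sum summableI)
    qed
  qed (use assms in \<open>auto simp: positive_def sets_dirac_sum\<close>)
  then show ?thesis using assms by simp
qed

section \<open>Set-valued maps\<close>

definition set_maps :: "'x measure \<Rightarrow> ('x \<Rightarrow> 'y set) set" where
  "set_maps \<omega> = {\<Phi>. (\<forall>x. \<Phi> x \<noteq> {}) \<and> (AE x in \<omega>. is_singleton (\<Phi> x))}"

definition sv_continuous_at :: "('x::metric_space \<Rightarrow> 'y::metric_space set) \<Rightarrow> 'x \<Rightarrow> bool" where
  "sv_continuous_at \<Phi> x0 \<longleftrightarrow>
     (\<forall>(xs::nat \<Rightarrow> 'x) ys. xs \<longlonglongrightarrow> x0 \<longrightarrow> (\<forall>k. ys k \<in> \<Phi> (xs k)) \<longrightarrow>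
        (\<exists>r y0. strict_mono (r::nat \<Rightarrow> nat) \<and> y0 \<in> \<Phi> x0 \<and> (ys \<circ> r) \<longlonglongrightarrow> y0))"

definition C_maps :: "'x::metric_space measure \<Rightarrow> ('x \<Rightarrow> 'y::metric_space set) set" where
  "C_maps \<omega> = {\<Phi> \<in> set_maps \<omega>. \<forall>x0. sv_continuous_at \<Phi> x0}"

definition Cs_maps :: "'x::metric_space measure \<Rightarrow> ('x \<Rightarrow> 'y::metric_space set) set" where
  "Cs_maps \<omega> = {\<Phi> \<in> C_maps \<omega>. (\<Union>x. \<Phi> x) = UNIV}"

definition sv_preimage :: "('x \<Rightarrow> 'y set) \<Rightarrow> 'y set \<Rightarrow> 'x set" where
  "sv_preimage \<Phi> E = {x. \<Phi> x \<inter> E \<noteq> {}}"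

definition pull_measure :: "'x measure \<Rightarrow> ('x \<Rightarrow> 'y::metric_space set) \<Rightarrow> 'y measure" where
  "pull_measure \<omega> \<Phi> = measure_of UNIV (sets borel) (\<lambda>E. emeasure \<omega> (sv_preimage \<Phi> E))"

lemma sets_pull_measure: "sets (pull_measure \<omega> \<Phi>) = sets borel"
  unfolding pull_measure_def using sets.sigma_sets_eq[of borel] by simp

lemma closed_sv_preimage:
  assumes "\<forall>x0. sv_continuous_at \<Phi> x0" and "closed E"
  shows "closed (sv_preimage \<Phi> E)"
  unfolding closed_sequential_limits
proof (intro allI impI, elim conjE)
  fix xs x0
  assume xs: "\<forall>n. xs n \<in> sv_preimage \<Phi> E" "xs \<longlonglongrightarrow> x0"
  then obtain ys where ys: "\<And>n. ys n \<in> \<Phi> (xs n)" "\<And>n. ys n \<in> E"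
    unfolding sv_preimage_def by (simp add: disjoint_iff) metis
  then obtain r y0 where "y0 \<in> \<Phi> x0" "(ys \<circ> r) \<longlonglongrightarrow> y0"
    using assms(1) xs(2) unfolding sv_continuous_at_def by metis
  moreover from this have "y0 \<in> E"
    using assms(2) ys(2) by (metis closed_sequentially comp_apply)
  ultimately show "x0 \<in> sv_preimage \<Phi> E" unfolding sv_preimage_def by auto
qed

lemma null_not_singleton:
  assumes "completed_radon_measure \<omega>" and "\<Phi> \<in> set_maps \<omega>"
  shows "{x. \<not> is_singleton (\<Phi> x)} \<in> null_sets \<omega>"
proof -
  obtain M0 where M0: "radon_measure M0" "\<omega> = completion M0"
    using assms(1) unfolding completed_radon_measure_def by auto
  then have "space \<omega> = UNIV"
    unfolding radon_measure_def by (metis sets_eq_imp_space_eq space_borel space_completion)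
  then obtain N where "N \<in> null_sets \<omega>" "{x. \<not> is_singleton (\<Phi> x)} \<subseteq> N"
    using assms(2) unfolding set_maps_def by (auto elim!: AE_E simp: null_sets_def)
  then show ?thesis using M0(2) by (metis null_sets_completion_subset)
qed

lemma sv_preimage_measurable:
  assumes "completed_radon_measure \<omega>" and "\<Phi> \<in> C_maps \<omega>" and "E \<in> sets borel"
  shows "sv_preimage \<Phi> E \<in> sets \<omega>"
proof -
  obtain M0 where M0: "radon_measure M0" "\<omega> = completion M0"
    using assms(1) unfolding completed_radon_measure_def by auto
  have closed: "K \<in> sets \<omega>" if "closed K" for K
    using M0 that unfolding radon_measure_def by (auto intro: sets_completionI_sets)
  have sp: "space \<omega> = UNIV"
    using M0 unfolding radon_measure_def by (metis sets_eq_imp_space_eq space_borel space_completion)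
  have E: "E \<in> sigma_sets UNIV (Collect closed)"
    using assms(3) by (simp add: borel_eq_closed)
  show ?thesis
    using E
  proof induction
    case (Basic K)
    then show ?case
      using assms(2) by (auto simp: C_maps_def intro!: closed closed_sv_preimage)
  next
    case Empty
    then show ?case by (simp add: sv_preimage_def)
  next
    case (Compl A)
    let ?N = "sv_preimage \<Phi> (UNIV - A) \<inter> sv_preimage \<Phi> A"
    have "?N \<subseteq> {x. \<not> is_singleton (\<Phi> x)}"
      by (auto simp: sv_preimage_def is_singleton_def)
    moreover have "{x. \<not> is_singleton (\<Phi> x)} \<in> null_sets \<omega>"
      using assms by (intro null_not_singleton) (auto simp: C_maps_def)
    ultimately have "?N \<in> sets \<omega>"
      using M0(2) by (metis null_sets_completion_subset null_setsD2)
    moreover have "sv_preimage \<Phi> (UNIV - A) = (UNIV - sv_preimage \<Phi> A) \<union> ?N"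
    proof -
      have "\<Phi> x \<noteq> {}" for x using assms(2) by (auto simp: C_maps_def set_maps_def)
      then show ?thesis by (fastforce simp: sv_preimage_def)
    qed
    ultimately show ?case using Compl.IH sp by (metis sets.Un sets.compl_sets)
  next
    case (Union A)
    have "sv_preimage \<Phi> (\<Union>i. A i) = (\<Union>i. sv_preimage \<Phi> (A i))"
      by (auto simp: sv_preimage_def)
    then show ?case using Union by auto
  qed
qed

lemma emeasure_pull_measure:
  assumes "completed_radon_measure \<omega>" and "\<Phi> \<in> C_maps \<omega>" and "E \<in> sets borel"
  shows "emeasure (pull_measure \<omega> \<Phi>) E = emeasure \<omega> (sv_preimage \<Phi> E)"
proof (rule emeasure_measure_of[OF pull_measure_def])
  let ?N = "{x. \<not> is_singleton (\<Phi> x)}"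
  have N: "?N \<in> null_sets \<omega>"
    using assms by (intro null_not_singleton) (auto simp: C_maps_def)
  show "countably_additive (sets (pull_measure \<omega> \<Phi>)) (\<lambda>E. emeasure \<omega> (sv_preimage \<Phi> E))"
  proof (rule countably_additiveI)
    fix A :: "nat \<Rightarrow> 'b set"
    assume A: "range A \<subseteq> sets (pull_measure \<omega> \<Phi>)" "disjoint_family A"
    have m: "sv_preimage \<Phi> (A i) \<in> sets \<omega>" for i
      using A(1) assms by (intro sv_preimage_measurable) (auto simp: sets_pull_measure)
    have disj: "disjoint_family (\<lambda>i. sv_preimage \<Phi> (A i) - ?N)"
      using A(2) unfolding disjoint_family_on_def sv_preimage_def is_singleton_def by fastforce
    have U: "sv_preimage \<Phi> (\<Union>i. A i) - ?N = (\<Union>i. sv_preimage \<Phi> (A i) - ?N)"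
      by (auto simp: sv_preimage_def)
    have mU: "sv_preimage \<Phi> (\<Union>i. A i) \<in> sets \<omega>"
      using A(1) assms by (intro sv_preimage_measurable) (auto simp: sets_pull_measure)
    have "(\<Sum>i. emeasure \<omega> (sv_preimage \<Phi> (A i))) =
        (\<Sum>i. emeasure \<omega> (sv_preimage \<Phi> (A i) - ?N))"
      using m N by (simp add: emeasure_Diff_null_set)
    also have "\<dots> = emeasure \<omega> (\<Union>i. sv_preimage \<Phi> (A i) - ?N)"
      using m N disj by (intro suminf_emeasure) auto
    also have "\<dots> = emeasure \<omega> (sv_preimage \<Phi> (\<Union>i. A i))"
      using mU N U by (metis emeasure_Diff_null_set)
    finally show "(\<Sum>i. emeasure \<omega> (sv_preimage \<Phi> (A i))) =
        emeasure \<omega> (sv_preimage \<Phi> (\<Union>i. A i))" .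
  qed
qed (use assms in \<open>auto simp: positive_def sets_pull_measure sv_preimage_def\<close>)

section \<open>Families of functions and the structural properties\<close>

text \<open>On a compact space every continuous function is bounded, so \<^typ>\<open>'x \<Rightarrow>\<^sub>C real\<close> is the space
  of all real continuous functions with the topology of uniform convergence.\<close>

definition C_plus :: "('x::metric_space \<Rightarrow>\<^sub>C real) set" where
  "C_plus = {f :: 'x \<Rightarrow>\<^sub>C real. \<forall>x. 0 < f x}"

definition bcf_max ::
  "('x::metric_space \<Rightarrow>\<^sub>C real) \<Rightarrow> ('x \<Rightarrow>\<^sub>C real) \<Rightarrow> ('x \<Rightarrow>\<^sub>C real)" where
  "bcf_max f g = Bcontfun (\<lambda>x. max (f x) (g x))"

lemma apply_bcf_max [simp]: "bcf_max f g x = max (f x) (g x)"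
proof -
  have "bounded (range f \<union> range g)" by simp
  then have "bounded (range (\<lambda>x. max (f x) (g x)))"
    by (rule bounded_subset) (auto simp: max_def)
  then have "(\<lambda>x. max (f x) (g x)) \<in> bcontfun"
    by (auto simp: bcontfun_def intro!: continuous_on_max)
  then show ?thesis by (simp add: bcf_max_def Bcontfun_inverse)
qed

definition op_continuous_at :: "('x::metric_space \<Rightarrow>\<^sub>C real) set \<Rightarrow>
    (('x \<Rightarrow>\<^sub>C real) \<Rightarrow> 'x \<Rightarrow> 'y::metric_space set) \<Rightarrow> ('x \<Rightarrow>\<^sub>C real) \<Rightarrow> bool" where
  "op_continuous_at F T \<phi> \<longleftrightarrow>
     (\<forall>(\<phi>s::nat \<Rightarrow> 'x \<Rightarrow>\<^sub>C real) x0 ys.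
        (\<forall>j. \<phi>s j \<in> F) \<longrightarrow> \<phi>s \<longlonglongrightarrow> \<phi> \<longrightarrow> (\<forall>j. ys j \<in> T (\<phi>s j) x0) \<longrightarrow>
        (\<exists>r y0. strict_mono (r::nat \<Rightarrow> nat) \<and> y0 \<in> T \<phi> x0 \<and> (ys \<circ> r) \<longlonglongrightarrow> y0))"

definition T_convex :: "'x::metric_space measure \<Rightarrow> ('x \<Rightarrow>\<^sub>C real) set \<Rightarrow>
    (('x \<Rightarrow>\<^sub>C real) \<Rightarrow> 'x \<Rightarrow> 'y::metric_space set) \<Rightarrow> bool" where
  "T_convex \<omega> F T \<longleftrightarrow>
     F \<subseteq> C_plus \<and>
     (\<forall>f1\<in>F. \<forall>f2\<in>F. bcf_max f1 f2 \<in> F) \<and>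
     (\<forall>\<phi>\<in>F. T \<phi> \<in> Cs_maps \<omega>) \<and>
     (\<forall>\<phi>\<in>F. op_continuous_at F T \<phi>) \<and>
     (\<forall>\<phi>1\<in>F. \<forall>\<phi>2\<in>F. \<forall>x0. apply_bcontfun \<phi>1 x0 \<ge> apply_bcontfun \<phi>2 x0 \<longrightarrow> T \<phi>1 x0 \<subseteq> T (bcf_max \<phi>1 \<phi>2) x0)"

text \<open>The endpoints may be infinite, so they are extended reals and \<^term>\<open>einterval (\<alpha> y) (\<beta> y)\<close> is
  the open interval of real parameters between them. Values of \<^term>\<open>h\<close> at parameters outside this
  interval are irrelevant. Convergence of \<^term>\<open>h t y\<close> and the norm are those of uniform
  convergence.\<close>

definition property_A3 :: "('x::metric_space \<Rightarrow>\<^sub>C real) set \<Rightarrow>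
    (('x \<Rightarrow>\<^sub>C real) \<Rightarrow> 'x \<Rightarrow> 'y::metric_space set) \<Rightarrow>
    ('y \<Rightarrow> ereal) \<Rightarrow> ('y \<Rightarrow> ereal) \<Rightarrow> (real \<Rightarrow> 'y \<Rightarrow> ('x \<Rightarrow>\<^sub>C real)) \<Rightarrow> bool" where
  "property_A3 F T \<alpha> \<beta> h \<longleftrightarrow> (\<forall>y.
     \<alpha> y < \<beta> y \<and>
     (\<forall>t\<in>einterval (\<alpha> y) (\<beta> y). h t y \<in> F) \<and>
     (\<forall>t\<in>einterval (\<alpha> y) (\<beta> y). \<forall>x. y \<in> T (h t y) x) \<and>
     (\<forall>t\<in>einterval (\<alpha> y) (\<beta> y). \<forall>s\<in>einterval (\<alpha> y) (\<beta> y). t \<le> s \<longrightarrow> (\<forall>x. h t y x \<ge> h s y x)) \<and>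
     ((\<lambda>t. h (real_of_ereal t) y) \<longlongrightarrow> 0) (at_left (\<beta> y)) \<and>
     (\<forall>t\<in>einterval (\<alpha> y) (\<beta> y). ((\<lambda>t'. norm (h t' y - h t y)) \<longlongrightarrow> 0) (at t)))"

end

theory Submission
  imports Defs
begin

text \<open>
  The solutions \<open>\<rho>s l\<close> of the discrete problems are squeezed between two positive constants that do
  not depend on \<open>l\<close>: at a point where \<open>\<rho>s l\<close> takes the value \<open>R0\<close>, one of the functions of which
  it is the maximum also takes this value, and so the Harnack-type hypothesis bounds \<open>\<rho>s l\<close> from
  below; the others are at most \<open>R0\<close> there and can be raised, by decreasing their parameter, to a
  member of the same family that takes the value \<open>R0\<close> at that point, and so they are bounded from
  above (\<open>parameter_attaining_value\<close>). Compactness then yields a uniform limit \<open>\<rho> \<in> F\<close> of a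
  subsequence.

  The measures pass to the limit because the measure that a continuous set-valued map with almost
  everywhere singleton values induces from the complete measure \<open>\<omega>\<close> is the ordinary image measure under any selection
  (\<open>pull_measure_eq_distr\<close>). Continuity of \<open>T\<close> makes these selections converge almost everywhere,
  so dominated convergence gives weak convergence of the measures (\<open>pull_measure_weakly_continuous\<close>).
  Since a weak limit of finite Borel measures on a metric space is unique, the measure of \<open>T \<rho>\<close> is
  \<open>\<mu>\<close>.
\<close>

section \<open>Uniqueness of weak limits\<close>

text \<open>The indicator of a nonempty closed set \<open>K\<close> is the decreasing limit of the continuous functions
  \<open>max 0 (1 - n * infdist y K)\<close>, and the closed sets form an intersection-stable generator of the
  Borel sets.\<close>

lemma finite_borel_measure_eqI:
  fixes M N :: "'a::metric_space measure"
  assumes "finite_measure M" "finite_measure N"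
    and sets: "sets M = sets borel" "sets N = sets borel"
    and eq: "\<And>f::'a \<Rightarrow> real. continuous_on UNIV f \<Longrightarrow> (\<And>y. 0 \<le> f y \<and> f y \<le> 1) \<Longrightarrow>
      (\<integral>y. f y \<partial>M) = (\<integral>y. f y \<partial>N)"
  shows "M = N"
proof (rule measure_eqI_generator_eq[where E = "Collect closed" and \<Omega> = UNIV and A = "\<lambda>_. UNIV"])
  interpret M: finite_measure M by fact
  interpret N: finite_measure N by fact
  show "Int_stable (Collect closed :: 'a set set)" by (auto simp: Int_stable_def)
  show "sets M = sigma_sets UNIV (Collect closed)" "sets N = sigma_sets UNIV (Collect closed)"
    using sets by (simp_all add: borel_eq_closed)
  show "emeasure M K = emeasure N K" if "K \<in> Collect closed" for K
  proof (cases "K = {}")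
    case False
    have K: "closed K" using that by simp
    define f where "f n y = max 0 (1 - real n * infdist y K)" for n y
    have cont: "continuous_on UNIV (f n)" for n
      unfolding f_def by (intro continuous_intros)
    have bound: "0 \<le> f n y \<and> f n y \<le> 1" for n y
      unfolding f_def by (auto simp: infdist_nonneg)
    have lim: "(\<lambda>n. f n y) \<longlonglongrightarrow> indicator K y" for y
    proof (cases "y \<in> K")
      case True
      then show ?thesis by (simp add: f_def)
    next
      case notin: False
      then have "infdist y K > 0"
        using K False infdist_pos_not_in_closed by metis
      then have "LIM n sequentially. real n * infdist y K :> at_top"
        by (intro filterlim_at_top_mult_tendsto_pos[OF tendsto_const]
            filterlim_real_sequentially) (simp_all add: mult.commute)
      then have "eventually (\<lambda>n. real n * infdist y K \<ge> 1) sequentially"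
        by (simp add: filterlim_at_top)
      then have "eventually (\<lambda>n. f n y = indicator K y) sequentially"
        by eventually_elim (use notin in \<open>simp add: f_def\<close>)
      then show ?thesis by (rule tendsto_eventually)
    qed
    have conv: "(\<lambda>n. \<integral>y. f n y \<partial>L) \<longlonglongrightarrow> measure L K"
      if "finite_measure L" and s: "sets L = sets borel" for L
    proof -
      interpret L: finite_measure L by fact
      have KL: "K \<in> sets L" using K s by simp
      have "(\<lambda>n. \<integral>y. f n y \<partial>L) \<longlonglongrightarrow> (\<integral>y. indicator K y \<partial>L)"
      proof (rule integral_dominated_convergence[where w = "\<lambda>_. 1"])
        show "f n \<in> borel_measurable L" for n
          using borel_measurable_continuous_onI[OF cont] measurable_cong_sets[OF s refl] by blast
      qed (use KL lim bound in auto)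
      then show ?thesis using KL by simp
    qed
    have "measure M K = measure N K"
      using conv[OF assms(1) sets(1)] conv[OF assms(2) sets(2)] eq[OF cont bound]
      by (simp add: LIMSEQ_unique)
    then show ?thesis by (simp add: M.emeasure_eq_measure N.emeasure_eq_measure)
  qed simp
qed (use finite_measure.emeasure_finite[OF assms(1)] in \<open>auto simp: less_top[symmetric]\<close>)

lemma weakly_converges_unique:
  fixes M N :: "'a::metric_space measure"
  assumes "weakly_converges Ms M" "weakly_converges Ms N"
    and "finite_measure M" "finite_measure N"
    and "sets M = sets borel" "sets N = sets borel"
  shows "M = N"
  using assms(3-6)
  by (rule finite_borel_measure_eqI)
    (use assms(1,2) in \<open>auto simp: weakly_converges_def intro: LIMSEQ_unique\<close>)

section \<open>Measures of set-valued maps as image measures\<close>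

lemma completed_radon_measureD:
  fixes \<omega> :: "'x::metric_space measure"
  assumes "completed_radon_measure \<omega>"
  shows "finite_measure \<omega>" and "space \<omega> = UNIV"
proof -
  obtain M0 where M0: "radon_measure M0" "\<omega> = completion M0"
    using assms unfolding completed_radon_measure_def by auto
  then have "finite_measure M0" and s: "sets M0 = sets borel"
    by (auto simp: radon_measure_def)
  then show "finite_measure \<omega>"
    using M0(2) finite_measure.emeasure_finite[of M0]
    by (intro finite_measureI) (simp add: emeasure_completion[OF sets.top] del: space_completion)
  show "space \<omega> = UNIV"
    using M0(2) sets_eq_imp_space_eq[OF s] by simp
qed

definition selection :: "('x \<Rightarrow> 'y set) \<Rightarrow> 'x \<Rightarrow> 'y" where
  "selection \<Phi> x = (SOME y. y \<in> \<Phi> x)"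

lemma selection_in: "\<Phi> \<in> set_maps \<omega> \<Longrightarrow> selection \<Phi> x \<in> \<Phi> x"
  by (simp add: selection_def set_maps_def some_in_eq)

text \<open>Where the values are singletons, a point lies in the preimage of \<open>E\<close> exactly when the selected
  value lies in \<open>E\<close>; the other points form a null set, all of whose subsets the
  complete measure \<open>\<omega>\<close> can measure.\<close>

lemma vimage_selection:
  fixes \<omega> :: "'x::metric_space measure" and \<Phi> :: "'x \<Rightarrow> 'y::metric_space set"
  assumes "completed_radon_measure \<omega>" and "\<Phi> \<in> C_maps \<omega>" and "E \<in> sets borel"
  shows "selection \<Phi> -` E \<in> sets \<omega>"
    and "emeasure \<omega> (selection \<Phi> -` E) = emeasure \<omega> (sv_preimage \<Phi> E)"
proof -
  let ?N = "{x. \<not> is_singleton (\<Phi> x)}"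
  let ?D = "sv_preimage \<Phi> E - selection \<Phi> -` E"
  have \<Phi>: "\<Phi> \<in> set_maps \<omega>" using assms(2) by (simp add: C_maps_def)
  have pre: "sv_preimage \<Phi> E \<in> sets \<omega>" using assms by (rule sv_preimage_measurable)
  have N: "?N \<in> null_sets \<omega>" using assms(1) \<Phi> by (rule null_not_singleton)
  have "?D \<subseteq> ?N"
  proof
    fix x assume "x \<in> ?D"
    then obtain y where "y \<in> \<Phi> x" "y \<noteq> selection \<Phi> x" by (auto simp: sv_preimage_def)
    then show "x \<in> ?N" using selection_in[OF \<Phi>, of x] by (auto simp: is_singleton_def)
  qed
  then have D: "?D \<in> null_sets \<omega>"
    using N assms(1) unfolding completed_radon_measure_def
    by (metis null_sets_completion_subset)
  have eq: "selection \<Phi> -` E = sv_preimage \<Phi> E - ?D"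
    using selection_in[OF \<Phi>] by (auto simp: sv_preimage_def)
  show "selection \<Phi> -` E \<in> sets \<omega>"
    using pre D eq by (metis null_setsD2 sets.Diff)
  show "emeasure \<omega> (selection \<Phi> -` E) = emeasure \<omega> (sv_preimage \<Phi> E)"
    using emeasure_Diff_null_set[OF D pre] eq by simp
qed

lemma measurable_selection:
  fixes \<omega> :: "'x::metric_space measure" and \<Phi> :: "'x \<Rightarrow> 'y::metric_space set"
  assumes "completed_radon_measure \<omega>" and "\<Phi> \<in> C_maps \<omega>"
  shows "selection \<Phi> \<in> measurable \<omega> borel"
  using vimage_selection(1)[OF assms] completed_radon_measureD(2)[OF assms(1)]
  by (auto simp: measurable_def)

lemma pull_measure_eq_distr:
  fixes \<omega> :: "'x::metric_space measure" and \<Phi> :: "'x \<Rightarrow> 'y::metric_space set"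
  assumes "completed_radon_measure \<omega>" and "\<Phi> \<in> C_maps \<omega>"
  shows "pull_measure \<omega> \<Phi> = distr \<omega> borel (selection \<Phi>)"
proof (rule measure_eqI)
  fix E assume "E \<in> sets (pull_measure \<omega> \<Phi>)"
  then have E: "E \<in> sets borel" by (simp add: sets_pull_measure)
  show "emeasure (pull_measure \<omega> \<Phi>) E = emeasure (distr \<omega> borel (selection \<Phi>)) E"
    using vimage_selection(2)[OF assms E] emeasure_pull_measure[OF assms E]
      emeasure_distr[OF measurable_selection[OF assms] E] completed_radon_measureD(2)[OF assms(1)]
    by simp
qed (simp add: sets_pull_measure)

lemma finite_pull_measure:
  fixes \<omega> :: "'x::metric_space measure" and \<Phi> :: "'x \<Rightarrow> 'y::metric_space set"
  assumes "completed_radon_measure \<omega>" and "\<Phi> \<in> C_maps \<omega>"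
  shows "finite_measure (pull_measure \<omega> \<Phi>)"
  using finite_measure.finite_measure_distr[OF completed_radon_measureD(1)[OF assms(1)]
      measurable_selection[OF assms]] pull_measure_eq_distr[OF assms] by simp

section \<open>Passage to the limit in the measures\<close>

text \<open>At a singleton value of \<open>T \<phi>\<close> the subsequential limits provided by continuity of \<open>T\<close> all
  coincide, so the whole sequence converges.\<close>

lemma op_continuous_at_singleton:
  fixes T :: "('x::metric_space \<Rightarrow>\<^sub>C real) \<Rightarrow> 'x \<Rightarrow> 'y::metric_space set"
  assumes cont: "op_continuous_at F T \<phi>" and F: "\<And>j. \<phi>s j \<in> F" and lim: "\<phi>s \<longlonglongrightarrow> \<phi>"
    and ys: "\<And>j. ys j \<in> T (\<phi>s j) x" and y: "T \<phi> x = {y}"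
  shows "ys \<longlonglongrightarrow> y"
proof (rule ccontr)
  assume "\<not> ys \<longlonglongrightarrow> y"
  then obtain e where e: "e > 0" "\<exists>\<^sub>F j in sequentially. \<not> dist (ys j) y < e"
    by (auto simp: tendsto_iff frequently_def)
  then have "infinite {j. \<not> dist (ys j) y < e}"
    by (simp add: frequently_cofinite[symmetric] cofinite_eq_sequentially)
  then obtain r :: "nat \<Rightarrow> nat" where r: "strict_mono r" "\<And>j. \<not> dist (ys (r j)) y < e"
    using infinite_enumerate by blast
  have "(\<phi>s \<circ> r) \<longlonglongrightarrow> \<phi>" using lim r(1) by (rule LIMSEQ_subseq_LIMSEQ)
  then obtain s y0 where "y0 \<in> T \<phi> x" "((ys \<circ> r) \<circ> s) \<longlonglongrightarrow> y0"
    using cont[unfolded op_continuous_at_def, rule_format, of "\<phi>s \<circ> r" "ys \<circ> r" x] F ys by auto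
  then have "((ys \<circ> r) \<circ> s) \<longlonglongrightarrow> y" using y by simp
  then have "\<forall>\<^sub>F j in sequentially. dist (ys (r (s j))) y < e"
    using e(1) by (auto simp: tendsto_iff)
  with r(2) show False by simp
qed

lemma pull_measure_weakly_continuous:
  fixes \<omega> :: "'x::metric_space measure"
    and T :: "('x \<Rightarrow>\<^sub>C real) \<Rightarrow> 'x \<Rightarrow> 'y::metric_space set"
  assumes Y: "compact (UNIV :: 'y set)" and omega: "completed_radon_measure \<omega>"
    and maps: "\<And>\<psi>. \<psi> \<in> F \<Longrightarrow> T \<psi> \<in> C_maps \<omega>" and cont: "op_continuous_at F T \<phi>"
    and F: "\<And>j. \<phi>s j \<in> F" "\<phi> \<in> F" and lim: "\<phi>s \<longlonglongrightarrow> \<phi>"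
  shows "weakly_converges (\<lambda>j. pull_measure \<omega> (T (\<phi>s j))) (pull_measure \<omega> (T \<phi>))"
  unfolding weakly_converges_def
proof (intro allI impI)
  fix f :: "'y \<Rightarrow> real" assume f: "continuous_on UNIV f"
  interpret finite_measure \<omega> using omega by (rule completed_radon_measureD)
  obtain B where B: "\<And>y. norm (f y) \<le> B"
    using compact_imp_bounded[OF compact_continuous_image[OF f Y]] by (auto simp: bounded_iff)
  have fm: "f \<in> borel_measurable borel" using f by (rule borel_measurable_continuous_onI)
  have sel: "selection (T \<psi>) \<in> measurable \<omega> borel" if "\<psi> \<in> F" for \<psi>
    using omega maps[OF that] by (rule measurable_selection)
  have int: "(\<integral>y. f y \<partial>pull_measure \<omega> (T \<psi>)) = (\<integral>x. f (selection (T \<psi>) x) \<partial>\<omega>)"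
    if "\<psi> \<in> F" for \<psi>
    using integral_distr[OF sel[OF that] fm] pull_measure_eq_distr[OF omega maps[OF that]] by simp
  have set_map: "T \<psi> \<in> set_maps \<omega>" if "\<psi> \<in> F" for \<psi>
    using maps[OF that] by (simp add: C_maps_def)
  have "AE x in \<omega>. is_singleton (T \<phi> x)"
    using set_map[OF F(2)] by (simp add: set_maps_def)
  then have "AE x in \<omega>. (\<lambda>j. f (selection (T (\<phi>s j)) x)) \<longlonglongrightarrow> f (selection (T \<phi>) x)"
  proof eventually_elim
    case (elim x)
    then have "T \<phi> x = {selection (T \<phi>) x}"
      using selection_in[OF set_map[OF F(2)], of x] by (auto simp: is_singleton_def)
    then have "(\<lambda>j. selection (T (\<phi>s j)) x) \<longlonglongrightarrow> selection (T \<phi>) x"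
      using selection_in[OF set_map[OF F(1)]]
      by (intro op_continuous_at_singleton[OF cont F(1) lim]) auto
    then show ?case
      using f by (intro continuous_on_tendsto_compose[OF f]) auto
  qed
  then have "(\<lambda>j. \<integral>x. f (selection (T (\<phi>s j)) x) \<partial>\<omega>) \<longlonglongrightarrow> (\<integral>x. f (selection (T \<phi>) x) \<partial>\<omega>)"
    by (intro integral_dominated_convergence[where w = "\<lambda>_. B"])
      (use B F sel fm in \<open>auto intro: measurable_compose\<close>)
  then show "(\<lambda>j. \<integral>y. f y \<partial>pull_measure \<omega> (T (\<phi>s j))) \<longlonglongrightarrow> (\<integral>y. f y \<partial>pull_measure \<omega> (T \<phi>))"
    using int F by simp
qed

section \<open>Maxima of members of the family\<close>

lemma Max_in_family:
  fixes F :: "('x::metric_space \<Rightarrow>\<^sub>C real) set" and \<rho> :: "'x \<Rightarrow>\<^sub>C real"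
  assumes max: "\<And>f1 f2. f1 \<in> F \<Longrightarrow> f2 \<in> F \<Longrightarrow> bcf_max f1 f2 \<in> F"
    and I: "finite I" "I \<noteq> {}" and f: "\<And>i. i \<in> I \<Longrightarrow> f i \<in> F"
    and \<rho>: "\<And>x. \<rho> x = (MAX i\<in>I. f i x)"
  shows "\<rho> \<in> F"
proof -
  have "\<exists>\<sigma>\<in>F. \<forall>x. apply_bcontfun \<sigma> x = (MAX i\<in>I. f i x)"
    using I f
  proof (induction I rule: finite_ne_induct)
    case (singleton i)
    then show ?case by auto
  next
    case (insert i I)
    then obtain \<sigma> where \<sigma>: "\<sigma> \<in> F" "\<forall>x. apply_bcontfun \<sigma> x = (MAX i\<in>I. f i x)" by auto
    show ?case
      by (rule bexI[of _ "bcf_max (f i) \<sigma>"]) (use insert \<sigma> max in auto)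
  qed
  then show ?thesis using \<rho> bcontfun_eqI by metis
qed

text \<open>As the parameter decreases from \<open>t\<close> to \<open>\<alpha> y\<close>, the value at \<open>x\<close> moves continuously from at most
  \<open>R\<close> to a limit above \<open>R\<close>, so the intermediate value theorem applies.\<close>

lemma parameter_attaining_value:
  fixes h :: "real \<Rightarrow> 'y::metric_space \<Rightarrow> ('x::metric_space \<Rightarrow>\<^sub>C real)"
  assumes A3: "property_A3 F T \<alpha> \<beta> h" and t: "t \<in> einterval (\<alpha> y) (\<beta> y)"
    and le: "h t y x \<le> R"
    and lim: "((\<lambda>t. ereal (h (real_of_ereal t) y x)) \<longlongrightarrow> L) (at_right (\<alpha> y))" "ereal R < L"
  obtains s where "s \<in> einterval (\<alpha> y) (\<beta> y)" "s \<le> t" "h s y x = R"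
proof -
  have "\<forall>\<^sub>F t in at_right (\<alpha> y). ereal R < ereal (h (real_of_ereal t) y x)"
    using order_tendstoD(1)[OF lim] .
  moreover have \<alpha>t: "\<alpha> y < ereal t" using t by (simp add: einterval_iff)
  ultimately obtain c where c: "c > \<alpha> y"
      "\<And>u. \<alpha> y < u \<Longrightarrow> u < c \<Longrightarrow> ereal R < ereal (h (real_of_ereal u) y x)"
    by (auto simp: eventually_at_right[OF \<alpha>t])
  have "\<alpha> y < min c (ereal t)" using c(1) \<alpha>t by simp
  then obtain u where u: "\<alpha> y < ereal u" "ereal u < min c (ereal t)"
    using ereal_dense2 by blast
  have gt: "R < h u y x" using c(2)[of "ereal u"] u by simp
  have ut: "u \<le> t" using u(2) by simp
  have dom: "s \<in> einterval (\<alpha> y) (\<beta> y)" if "u \<le> s" "s \<le> t" for s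
  proof -
    have "ereal u \<le> ereal s" "ereal s \<le> ereal t" using that by simp_all
    then show ?thesis
      using u(1) t unfolding einterval_iff by (meson le_less_trans less_le_trans)
  qed
  have "isCont (\<lambda>s. h s y x) s" if "u \<le> s" "s \<le> t" for s
  proof -
    have "((\<lambda>s'. norm (h s' y - h s y)) \<longlongrightarrow> 0) (at s)"
      using A3 dom[OF that] by (auto simp: property_A3_def)
    then have "((\<lambda>s'. h s' y) \<longlongrightarrow> h s y) (at s)"
      by (simp add: tendsto_norm_zero_iff Lim_null[symmetric])
    then have "uniform_limit UNIV (\<lambda>s'. apply_bcontfun (h s' y)) (h s y) (at s)"
      by (rule tendsto_bcontfun_uniform_limit)
    then show ?thesis
      unfolding isCont_def by (rule tendsto_uniform_limitI) simp
  qed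
  then obtain s where "u \<le> s" "s \<le> t" "h s y x = R"
    using IVT2[of "\<lambda>s. h s y x" t R u] le gt ut by auto
  with dom show ?thesis by (intro that)
qed

text \<open>Both bounds are governed by a single point at which the maximum equals \<open>R\<close>: the lower one
  comes from a member that attains the maximum there, the upper one from raising each member until
  it takes the value \<open>R\<close> there.\<close>

lemma Max_bounds:
  fixes h :: "real \<Rightarrow> 'y::metric_space \<Rightarrow> ('x::metric_space \<Rightarrow>\<^sub>C real)" and \<rho> :: "'x \<Rightarrow>\<^sub>C real"
  assumes A3: "property_A3 F T \<alpha> \<beta> h"
    and I: "finite I" "I \<noteq> {}" and b: "\<And>i. i \<in> I \<Longrightarrow> b i \<in> einterval (\<alpha> (p i)) (\<beta> (p i))"
    and \<rho>: "\<And>x. \<rho> x = (MAX i\<in>I. h (b i) (p i) x)" and R: "R \<in> range \<rho>"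
    and lim: "\<And>x y. \<exists>L::ereal.
          ((\<lambda>t. ereal (h (real_of_ereal t) y x)) \<longlongrightarrow> L) (at_right (\<alpha> y)) \<and> ereal R < L"
    and harnack: "\<And>y t x. t \<in> einterval (\<alpha> y) (\<beta> y) \<Longrightarrow> R \<in> range (h t y) \<Longrightarrow>
          c \<le> h t y x \<and> h t y x \<le> C"
  shows "c \<le> \<rho> x \<and> \<rho> x \<le> C"
proof
  obtain x0 where x0: "\<rho> x0 = R" using R by auto
  have "R \<in> (\<lambda>i. h (b i) (p i) x0) ` I"
    using Max_in[of "(\<lambda>i. h (b i) (p i) x0) ` I"] I unfolding \<rho>[symmetric] x0 by simp
  then obtain i where i: "i \<in> I" "h (b i) (p i) x0 = R" by auto
  then have "c \<le> h (b i) (p i) x" using harnack[OF b[OF i(1)]] by blast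
  also have "\<dots> \<le> \<rho> x" using i I by (simp add: \<rho>)
  finally show "c \<le> \<rho> x" .
  have "h (b i) (p i) x \<le> C" if i: "i \<in> I" for i
  proof -
    have "h (b i) (p i) x0 \<le> (MAX i\<in>I. h (b i) (p i) x0)" using i I by simp
    then have le: "h (b i) (p i) x0 \<le> R" by (simp only: \<rho>[symmetric] x0)
    obtain L where L: "((\<lambda>t. ereal (h (real_of_ereal t) (p i) x0)) \<longlongrightarrow> L) (at_right (\<alpha> (p i)))"
        "ereal R < L"
      using lim by blast
    obtain s where s: "s \<in> einterval (\<alpha> (p i)) (\<beta> (p i))" "s \<le> b i" "h s (p i) x0 = R"
      using parameter_attaining_value[OF A3 b[OF i] le L] .
    have "h (b i) (p i) x \<le> h s (p i) x"
      using A3 s(1,2) b[OF i] by (auto simp: property_A3_def)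
    also have "\<dots> \<le> C" using harnack[OF s(1)] s(3) by blast
    finally show ?thesis .
  qed
  then show "\<rho> x \<le> C" using I by (simp add: \<rho>)
qed

section \<open>Solution for a general right-hand side\<close>

theorem theorem2p11:
  fixes \<omega> :: "'x::metric_space measure"
    and F :: "('x \<Rightarrow>\<^sub>C real) set"
    and T :: "('x \<Rightarrow>\<^sub>C real) \<Rightarrow> 'x \<Rightarrow> 'y::metric_space set"
    and \<alpha> \<beta> :: "'y \<Rightarrow> ereal"
    and h :: "real \<Rightarrow> 'y \<Rightarrow> ('x \<Rightarrow>\<^sub>C real)"
    and \<mu> :: "'y measure"
    and \<mu>s :: "nat \<Rightarrow> 'y measure"
    and N :: "nat \<Rightarrow> nat"
    and g :: "nat \<Rightarrow> nat \<Rightarrow> real"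
    and p :: "nat \<Rightarrow> nat \<Rightarrow> 'y"
    and b :: "nat \<Rightarrow> nat \<Rightarrow> real"
    and \<rho>s :: "nat \<Rightarrow> ('x \<Rightarrow>\<^sub>C real)"
    and R0 :: real
  assumes compact_X: "compact (UNIV :: 'x set)"
    and compact_Y: "compact (UNIV :: 'y set)"
    and omega: "completed_radon_measure \<omega>"
    and convex: "T_convex \<omega> F T"
    and A3: "property_A3 F T \<alpha> \<beta> h"
    and N_ge_2: "\<And>l. l \<ge> 1 \<Longrightarrow> N l \<ge> 2"
    and p_distinct: "\<And>l. l \<ge> 1 \<Longrightarrow> inj_on (p l) {1..N l}"
    and g_pos: "\<And>l i. l \<ge> 1 \<Longrightarrow> i \<in> {1..N l} \<Longrightarrow> g l i > 0"
    and mu_discrete: "\<And>l. l \<ge> 1 \<Longrightarrow> \<mu>s l = dirac_sum (N l) (g l) (p l)"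
    and mu_radon: "radon_measure \<mu>"
    and mu_weak: "weakly_converges \<mu>s \<mu>"
    and mass: "\<And>l. l \<ge> 1 \<Longrightarrow> emeasure (\<mu>s l) UNIV = emeasure \<omega> UNIV"
    and b_range: "\<And>l i. l \<ge> 1 \<Longrightarrow> i \<in> {1..N l} \<Longrightarrow> b l i \<in> einterval (\<alpha> (p l i)) (\<beta> (p l i))"
    and rho_form: "\<And>l x. l \<ge> 1 \<Longrightarrow> \<rho>s l x = (MAX i\<in>{1..N l}. h (b l i) (p l i) x)"
    and rho_solves: "\<And>l. l \<ge> 1 \<Longrightarrow> pull_measure \<omega> (T (\<rho>s l)) = \<mu>s l"
    and R0_pos: "R0 > 0"
    and R0_range: "\<And>l. l \<ge> 1 \<Longrightarrow> R0 \<in> range (\<rho>s l)"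
    and R0_limit: "\<And>x y. \<exists>L::ereal.
          ((\<lambda>t. ereal (h (real_of_ereal t) y x)) \<longlongrightarrow> L) (at_right (\<alpha> y)) \<and> ereal R0 < L"
    and hyp_i: "\<And>R1. R1 > 0 \<Longrightarrow> \<exists>C>0. \<forall>y. \<forall>t\<in>einterval (\<alpha> y) (\<beta> y).
          R1 \<in> range (h t y) \<longrightarrow> (\<forall>x. inverse C \<le> h t y x \<and> h t y x \<le> C)"
    and hyp_ii: "\<And>C0 C1. 0 < C0 \<Longrightarrow> C0 < C1 \<Longrightarrow> 
            compact {f \<in> F. \<forall>x. C0 \<le> apply_bcontfun f x \<and> apply_bcontfun f x \<le> C1}"
  shows "\<exists>\<rho>\<in>F. pull_measure \<omega> (T \<rho>) = \<mu>"
proof -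
  have maps: "T \<psi> \<in> C_maps \<omega>" if "\<psi> \<in> F" for \<psi>
    using convex that by (auto simp: T_convex_def Cs_maps_def)
  obtain C where C: "C > 0" "\<And>y t x. t \<in> einterval (\<alpha> y) (\<beta> y) \<Longrightarrow> R0 \<in> range (h t y) \<Longrightarrow>
      inverse C \<le> h t y x \<and> h t y x \<le> C"
    using hyp_i[OF R0_pos] by metis
  \<comment> \<open>The upper bound is enlarged only to make it strictly larger than the lower one.\<close>
  define K where
    "K = {f \<in> F. \<forall>x. inverse C \<le> apply_bcontfun f x \<and> apply_bcontfun f x \<le> C + inverse C}"
  have "compact K" unfolding K_def using C(1) by (intro hyp_ii) auto
  have in_K: "\<rho>s (Suc l) \<in> K" for l
  proof -
    let ?I = "{1..N (Suc l)}"
    have I: "finite ?I" "?I \<noteq> {}" using N_ge_2[of "Suc l"] by auto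
    have "\<rho>s (Suc l) \<in> F"
      by (rule Max_in_family[OF _ I, where f = "\<lambda>i. h (b (Suc l) i) (p (Suc l) i)"])
        (use convex A3 b_range[of "Suc l"] rho_form[of "Suc l"] in
          \<open>auto simp: T_convex_def property_A3_def\<close>)
    moreover have "inverse C \<le> \<rho>s (Suc l) x \<and> \<rho>s (Suc l) x \<le> C" for x
      by (rule Max_bounds[OF A3 I b_range rho_form R0_range R0_limit C(2)]) auto
    ultimately show ?thesis
      using C(1) by (auto simp: K_def intro: add_increasing2)
  qed
  then obtain \<rho> r where r: "\<rho> \<in> K" "strict_mono r" "((\<lambda>l. \<rho>s (Suc l)) \<circ> r) \<longlonglongrightarrow> \<rho>"
    using \<open>compact K\<close> unfolding compact_def by metis
  have \<rho>: "\<rho> \<in> F" using r(1) by (simp add: K_def)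
  have "weakly_converges (\<lambda>j. pull_measure \<omega> (T (\<rho>s (Suc (r j))))) (pull_measure \<omega> (T \<rho>))"
    using in_K r(3) \<rho> convex
    by (intro pull_measure_weakly_continuous[OF compact_Y omega maps])
      (auto simp: K_def T_convex_def comp_def)
  then have 1: "weakly_converges (\<lambda>j. \<mu>s (Suc (r j))) (pull_measure \<omega> (T \<rho>))"
    by (simp add: rho_solves)
  have "strict_mono (\<lambda>j. Suc (r j))" using r(2) by (simp add: strict_mono_def)
  then have 2: "weakly_converges (\<lambda>j. \<mu>s (Suc (r j))) \<mu>"
    using mu_weak LIMSEQ_subseq_LIMSEQ unfolding weakly_converges_def comp_def by blast
  have "pull_measure \<omega> (T \<rho>) = \<mu>"
    using finite_pull_measure[OF omega maps[OF \<rho>]] mu_radon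
    by (intro weakly_converges_unique[OF 1 2]) (auto simp: radon_measure_def sets_pull_measure)
  with \<rho> show ?thesis ..
qed

end
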